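(* For all positive integers $m,n$, the domination polynomial $D(K_m \,\square\, K_n, x)$ is unimodal.
   Context: For a finite simple graph $G$, a set $U \subseteq V(G)$ is dominating if every vertex is in $U$ or adjacent to a vertex of $U$; $d_i(G)$ is the number of dominating sets of size $i$ and $D(G,x)=\sum_{i} d_i(G)x^i$ is the domination polynomial. A polynomial is unimodal if its coefficients (ordered by increasing power of $x$) are non-decreasing and then non-increasing. $K_n$ is the complete graph on $n$ vertices. The Cartesian product $G\,\square\, H$ has vertex set $V(G)\times V(H)$, with $(g,h)$ adjacent to $(g',h')$ iff either $g=g'$ and $\{h,h'\}\in E(H)$, or $\{g,g'\}\in E(G)$ and $h=h'$. *)

theory Defs
  imports "HOL-Computational_Algebra.Polynomial"
begin

text \<open>Finite simple graphs: a finite vertex set with a set of two-element subsets of it as edges.\<close>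

record 'a graph =
  verts :: "'a set"
  edges :: "'a set set"

definition finite_simple_graph :: "'a graph \<Rightarrow> bool" where
  "finite_simple_graph G \<longleftrightarrow>
     finite (verts G) \<and> (\<forall>e\<in>edges G. e \<subseteq> verts G \<and> card e = 2)"

definition complete_graph :: "nat \<Rightarrow> nat graph" where
  "complete_graph n = \<lparr>verts = {1..n}, edges = {e. e \<subseteq> {1..n} \<and> card e = 2}\<rparr>"

definition cartesian_product :: "'a graph \<Rightarrow> 'b graph \<Rightarrow> ('a \<times> 'b) graph"  (infixr \<open>\<box>\<close> 80) where
  "G \<box> H = \<lparr>verts = verts G \<times> verts H,
     edges = {{(g, h), (g', h')} | g h g' h'.
       (g, h) \<in> verts G \<times> verts H \<and> (g', h') \<in> verts G \<times> verts H \<and>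
       (g = g' \<and> {h, h'} \<in> edges H \<or> {g, g'} \<in> edges G \<and> h = h')}\<rparr>"

definition dominating :: "'a graph \<Rightarrow> 'a set \<Rightarrow> bool" where
  "dominating G U \<longleftrightarrow>
     U \<subseteq> verts G \<and> (\<forall>v\<in>verts G. v \<in> U \<or> (\<exists>u\<in>U. {u, v} \<in> edges G))"

definition num_dominating :: "'a graph \<Rightarrow> nat \<Rightarrow> nat" where
  "num_dominating G i = card {U. dominating G U \<and> card U = i}"

text \<open>No dominating set has more than \<open>card (verts G)\<close> elements, so the sum may stop there.\<close>

definition domination_poly :: "'a graph \<Rightarrow> int poly" where
  "domination_poly G = (\<Sum>i\<le>card (verts G). monom (int (num_dominating G i)) i)"

definition unimodal :: "'a::linordered_idom poly \<Rightarrow> bool" where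
  "unimodal p \<longleftrightarrow>
     (\<exists>k\<le>degree p. (\<forall>i j. i \<le> j \<and> j \<le> k \<longrightarrow> coeff p i \<le> coeff p j) \<and>
        (\<forall>i j. k \<le> i \<and> i \<le> j \<and> j \<le> degree p \<longrightarrow> coeff p j \<le> coeff p i))"

lemma finite_simple_graph_complete_graph: "finite_simple_graph (complete_graph n)"
  by (simp add: finite_simple_graph_def complete_graph_def)

lemma finite_simple_graph_cartesian_product:
  assumes "finite_simple_graph G" and "finite_simple_graph H"
  shows "finite_simple_graph (G \<box> H)"
proof -
  have no_loop: "{x} \<notin> edges G" "{y} \<notin> edges H" for x y
    using assms by (auto simp: finite_simple_graph_def)
  have "card e = 2 \<and> e \<subseteq> verts G \<times> verts H" if "e \<in> edges (G \<box> H)" for e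
  proof -
    obtain g h g' h' where e: "e = {(g, h), (g', h')}"
      and v: "(g, h) \<in> verts G \<times> verts H" "(g', h') \<in> verts G \<times> verts H"
      and adj: "g = g' \<and> {h, h'} \<in> edges H \<or> {g, g'} \<in> edges G \<and> h = h'"
      using \<open>e \<in> edges (G \<box> H)\<close> unfolding cartesian_product_def by auto
    have "(g, h) \<noteq> (g', h')" using adj no_loop by auto
    then show ?thesis using e v by simp
  qed
  then show ?thesis
    using assms by (auto simp: finite_simple_graph_def cartesian_product_def)
qed

lemma coeff_domination_poly:
  assumes "finite_simple_graph G"
  shows "coeff (domination_poly G) i = int (num_dominating G i)"
proof (cases "i \<le> card (verts G)")
  case True
  then show ?thesis by (simp add: domination_poly_def coeff_sum)
next
  case False
  have "{U. dominating G U \<and> card U = i} = {}"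
    using False assms card_mono[of "verts G"]
    by (auto simp: dominating_def finite_simple_graph_def)
  with False show ?thesis
    by (simp add: domination_poly_def num_dominating_def coeff_sum del: Collect_empty_eq)
qed

end

theory Submission
  imports Defs
begin

text \<open>
  Let \<open>d i\<close> count the dominating sets of size \<open>i\<close> in a graph on \<open>N\<close> vertices all of whose closed
  neighbourhoods have \<open>k\<close> elements. Count the pairs of a dominating set of size \<open>i + 1\<close> and one of
  its elements, removing that element. Since supersets of dominating sets dominate, this gives
  \<open>(N - i) d i \<le> (i + 1) d (i + 1)\<close>, so \<open>d\<close> increases up to the middle. Conversely, a set that
  misses some closed neighbourhood can only become dominating by adding one of the \<open>k\<close> vertices of
  that neighbourhood, whence \<open>(i + 1) d (i + 1) \<le> (N - i) d i + k e i\<close>, where \<open>e i\<close> counts the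
  non-dominating sets. As \<open>e i \<le> N (N - k choose i)\<close>, which for \<open>2 i \<ge> N\<close> is at most
  \<open>N (N choose i) / 2 ^ k\<close>, the sequence decreases from the middle on once \<open>(k + 1) N \<le> 2 ^ k\<close>.
  For \<open>K\<^sub>m \<box> K\<^sub>n\<close> we have \<open>k = m + n - 1\<close> and \<open>N = m n\<close>, so this covers \<open>m + n \<ge> 8\<close>; in the remaining
  cases \<open>N - k choose i\<close> vanishes for \<open>2 i \<ge> N\<close>, except when \<open>{m, n} = {3, 4}\<close> and \<open>i = 6\<close>.
\<close>

section \<open>Double counting of one-element extensions\<close>

text \<open>Deleting \<open>v\<close> from \<open>S\<close> matches the pairs \<open>(S, v)\<close>
  with \<open>v \<in> S\<close> to the pairs \<open>(T, v)\<close> with \<open>v \<notin> T\<close>;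
  each side counts one family.\<close>

lemma sum_card_extensions:
  assumes "finite V"
  shows "Suc i * card {S. S \<subseteq> V \<and> P S \<and> card S = Suc i} =
    (\<Sum>T | T \<subseteq> V \<and> card T = i. card {v \<in> V - T. P (insert v T)})"
proof -
  let ?A = "{S. S \<subseteq> V \<and> P S \<and> card S = Suc i}"
  let ?B = "{T. T \<subseteq> V \<and> card T = i}"
  let ?E = "\<lambda>T. {v \<in> V - T. P (insert v T)}"
  have fin: "finite ?A" "finite ?B"
    using assms by auto
  have finS: "finite S" if "S \<subseteq> V" for S
    using assms that by (rule rev_finite_subset)
  have "bij_betw (\<lambda>(S, v). (S - {v}, v)) (Sigma ?A (\<lambda>S. S)) (Sigma ?B ?E)"
    by (rule bij_betw_byWitness[where f' = "\<lambda>(T, v). (insert v T, v)"])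
       (auto simp: finS insert_absorb)
  then have "card (Sigma ?A (\<lambda>S. S)) = card (Sigma ?B ?E)"
    by (rule bij_betw_same_card)
  moreover have "card (Sigma ?A (\<lambda>S. S)) = (\<Sum>S\<in>?A. card S)"
    using fin finS by (intro card_SigmaI) auto
  moreover have "card (Sigma ?B ?E) = (\<Sum>T\<in>?B. card (?E T))"
    using fin assms by (intro card_SigmaI) auto
  ultimately show ?thesis
    by (simp add: mult.commute)
qed

definition closed_nbhd :: "'a graph \<Rightarrow> 'a \<Rightarrow> 'a set" where
  "closed_nbhd G v = {u \<in> verts G. u = v \<or> {u, v} \<in> edges G}"

text \<open>Failing to dominate becomes missing an entire closed neighbourhood, the form that both
  upper bounds use.\<close>

lemma dominating_iff_closed_nbhd:
  "dominating G U \<longleftrightarrow> U \<subseteq> verts G \<and> (\<forall>v\<in>verts G. U \<inter> closed_nbhd G v \<noteq> {})"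
  unfolding dominating_def closed_nbhd_def by blast

lemma dominating_mono:
  "dominating G U \<Longrightarrow> U \<subseteq> W \<Longrightarrow> W \<subseteq> verts G \<Longrightarrow> dominating G W"
  unfolding dominating_def by blast

lemma num_dominating_alt:
  "num_dominating G i = card {U. U \<subseteq> verts G \<and> dominating G U \<and> card U = i}"
  unfolding num_dominating_def dominating_def by (rule arg_cong[of _ _ card]) auto

definition num_nondominating :: "'a graph \<Rightarrow> nat \<Rightarrow> nat" where
  "num_nondominating G i = card {U. U \<subseteq> verts G \<and> \<not> dominating G U \<and> card U = i}"

lemma num_dominating_add_num_nondominating:
  assumes "finite (verts G)"
  shows "num_dominating G i + num_nondominating G i = card (verts G) choose i"
proof -
  let ?D = "{U. U \<subseteq> verts G \<and> dominating G U \<and> card U = i}"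
  let ?E = "{U. U \<subseteq> verts G \<and> \<not> dominating G U \<and> card U = i}"
  have "card (?D \<union> ?E) = card ?D + card ?E"
    using assms by (intro card_Un_disjoint) auto
  moreover have "?D \<union> ?E = {U. U \<subseteq> verts G \<and> card U = i}"
    by auto
  ultimately show ?thesis
    using n_subsets[OF assms, of i] by (simp add: num_dominating_alt num_nondominating_def)
qed

text \<open>A dominating \<open>T\<close> stays dominating under all of its extensions, so only
  non-dominating \<open>T\<close> leave an unevaluated sum. Bounding it below by 0 and above by
  \<open>k\<close> per set yields ascent and descent.\<close>

lemma sum_card_dominating_extensions:
  fixes G :: "'a graph"
  assumes "finite (verts G)"
  defines "ext \<equiv> \<lambda>T. card {v \<in> verts G - T. dominating G (insert v T)}"
  shows "Suc i * num_dominating G (Suc i) = (card (verts G) - i) * num_dominating G i +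
    (\<Sum>T | T \<subseteq> verts G \<and> \<not> dominating G T \<and> card T = i. ext T)"
proof -
  let ?D = "{T. T \<subseteq> verts G \<and> dominating G T \<and> card T = i}"
  let ?E = "{T. T \<subseteq> verts G \<and> \<not> dominating G T \<and> card T = i}"
  have "{T. T \<subseteq> verts G \<and> card T = i} = ?D \<union> ?E"
    by auto
  then have "Suc i * num_dominating G (Suc i) = sum ext (?D \<union> ?E)"
    using sum_card_extensions[OF assms(1), of i "dominating G"]
    by (simp add: num_dominating_alt ext_def)
  also have "\<dots> = sum ext ?D + sum ext ?E"
    using assms(1) by (intro sum.union_disjoint) auto
  also have "sum ext ?D = (\<Sum>T\<in>?D. card (verts G) - i)"
  proof (rule sum.cong)
    fix T assume T: "T \<in> ?D"
    then have "dominating G (insert v T)" if "v \<in> verts G" for v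
      using dominating_mono[of G T "insert v T"] that by auto
    then have "{v \<in> verts G - T. dominating G (insert v T)} = verts G - T"
      by auto
    then show "ext T = card (verts G) - i"
      using T card_Diff_subset[of T "verts G"] finite_subset[of T "verts G"] assms(1)
      by (simp add: ext_def)
  qed simp
  finally show ?thesis
    by (simp add: num_dominating_alt)
qed

section \<open>Ascent and descent in regular graphs\<close>

lemma num_dominating_le_Suc:
  assumes "finite (verts G)" and "2 * i < card (verts G)"
  shows "num_dominating G i \<le> num_dominating G (Suc i)"
proof -
  have "Suc i * num_dominating G i \<le> (card (verts G) - i) * num_dominating G i"
    using assms(2) by (intro mult_right_mono) auto
  also have "\<dots> \<le> Suc i * num_dominating G (Suc i)"
    using sum_card_dominating_extensions[OF assms(1), of i] by linarith
  finally show ?thesis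
    by (simp only: Suc_mult_le_cancel1)
qed

lemma num_dominating_Suc_upper:
  assumes "finite (verts G)" and "\<And>v. v \<in> verts G \<Longrightarrow> card (closed_nbhd G v) = k"
  shows "Suc i * num_dominating G (Suc i) \<le>
    (card (verts G) - i) * num_dominating G i + k * num_nondominating G i"
proof -
  have "card {v \<in> verts G - T. dominating G (insert v T)} \<le> k"
    if T: "T \<subseteq> verts G" "\<not> dominating G T" for T
  proof -
    obtain w where w: "w \<in> verts G" "T \<inter> closed_nbhd G w = {}"
      using T unfolding dominating_iff_closed_nbhd by blast
    then have "{v \<in> verts G - T. dominating G (insert v T)} \<subseteq> closed_nbhd G w"
      by (fastforce simp: dominating_iff_closed_nbhd)
    moreover have "finite (closed_nbhd G w)"
      using assms(1) by (simp add: closed_nbhd_def)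
    ultimately show ?thesis
      using assms(2)[OF w(1)] card_mono by metis
  qed
  then have "(\<Sum>T | T \<subseteq> verts G \<and> \<not> dominating G T \<and> card T = i.
      card {v \<in> verts G - T. dominating G (insert v T)}) \<le> num_nondominating G i * k"
    unfolding num_nondominating_def by (intro sum_bounded_above[where 'a = nat, simplified]) auto
  then show ?thesis
    using sum_card_dominating_extensions[OF assms(1), of i] by (simp add: mult.commute)
qed

text \<open>Union bound over the vertex whose closed neighbourhood is missed: the set lies in the
  complement of that neighbourhood.\<close>

lemma num_nondominating_upper:
  assumes "finite (verts G)" and "\<And>v. v \<in> verts G \<Longrightarrow> card (closed_nbhd G v) = k"
  shows "num_nondominating G i \<le> card (verts G) * ((card (verts G) - k) choose i)"
proof -
  let ?A = "\<lambda>w. {U. U \<subseteq> verts G - closed_nbhd G w \<and> card U = i}"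
  have "{U. U \<subseteq> verts G \<and> \<not> dominating G U \<and> card U = i} \<subseteq> (\<Union>w\<in>verts G. ?A w)"
    by (auto simp: dominating_iff_closed_nbhd)
  then have "num_nondominating G i \<le> card (\<Union>w\<in>verts G. ?A w)"
    unfolding num_nondominating_def using assms(1) by (intro card_mono) auto
  also have "\<dots> \<le> (\<Sum>w\<in>verts G. card (?A w))"
    using assms(1) by (rule card_UN_le)
  also have "\<dots> = (\<Sum>w\<in>verts G. (card (verts G) - k) choose i)"
  proof (rule sum.cong)
    fix w assume w: "w \<in> verts G"
    have "closed_nbhd G w \<subseteq> verts G"
      by (auto simp: closed_nbhd_def)
    then have "card (verts G - closed_nbhd G w) = card (verts G) - k"
      using assms w by (simp add: card_Diff_subset finite_subset)
    then show "card (?A w) = (card (verts G) - k) choose i"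
      using n_subsets[of "verts G - closed_nbhd G w" i] assms(1) by simp
  qed simp
  finally show ?thesis
    by simp
qed

text \<open>With \<open>d\<close> dominating and \<open>e\<close> non-dominating sets of size
  \<open>i\<close>, \<open>small\<close> gives \<open>(k + 1) * e \<le> d + e\<close>, so the error
  term \<open>k * e\<close> is at most \<open>d\<close>.\<close>

lemma num_dominating_Suc_le:
  assumes fin: "finite (verts G)"
    and reg: "\<And>v. v \<in> verts G \<Longrightarrow> card (closed_nbhd G v) = k"
    and i: "card (verts G) \<le> 2 * i"
    and small: "Suc k * card (verts G) * ((card (verts G) - k) choose i) \<le> card (verts G) choose i"
  shows "num_dominating G (Suc i) \<le> num_dominating G i"
proof -
  let ?N = "card (verts G)" and ?d = "num_dominating G" and ?e = "num_nondominating G"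
  \<comment> \<open>For \<open>i \<le> ?N\<close> this is the exact gap between the factors
    \<open>?N - i\<close> and \<open>Suc i\<close>; it is positive since
    \<open>?N \<le> 2 * i\<close>.\<close>
  define t where "t = Suc (2 * i) - ?N"
  have t: "1 \<le> t" using i by (simp add: t_def)
  have "Suc k * ?e i \<le> Suc k * (?N * ((?N - k) choose i))"
    using num_nondominating_upper[OF fin reg] by (intro mult_left_mono) auto
  also have "\<dots> \<le> ?d i + ?e i"
    using small num_dominating_add_num_nondominating[OF fin, of i] by (simp only: mult.assoc)
  finally have "k * ?e i \<le> 1 * ?d i"
    by simp
  also have "\<dots> \<le> t * ?d i"
    using t by (intro mult_right_mono) auto
  finally have ke: "k * ?e i \<le> t * ?d i" .
  have "Suc i * ?d (Suc i) \<le> (?N - i) * ?d i + t * ?d i"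
    using num_dominating_Suc_upper[OF fin reg, of i] ke by linarith
  also have "\<dots> = (?N - i + t) * ?d i"
    by (simp add: add_mult_distrib)
  finally have *: "Suc i * ?d (Suc i) \<le> (?N - i + t) * ?d i" .
  show ?thesis
  proof (cases "i \<le> ?N")
    case True
    then have "?N - i + t = Suc i"
      using i by (simp add: t_def)
    with * show ?thesis
      by (simp only: Suc_mult_le_cancel1)
  next
    \<comment> \<open>Truncated subtraction breaks the identity for \<open>?N - i + t\<close>, but
      no subset has \<open>Suc i\<close> elements.\<close>
    case False
    then show ?thesis
      using num_dominating_add_num_nondominating[OF fin, of "Suc i"] by (simp add: binomial_eq_0)
  qed
qed

lemma unimodal_domination_poly_regular:
  assumes G: "finite_simple_graph G"
    and reg: "\<And>v. v \<in> verts G \<Longrightarrow> card (closed_nbhd G v) = k"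
    and small: "\<And>i. card (verts G) \<le> 2 * i \<Longrightarrow>
      Suc k * card (verts G) * ((card (verts G) - k) choose i) \<le> card (verts G) choose i"
  shows "unimodal (domination_poly G)"
proof -
  let ?N = "card (verts G)"
  \<comment> \<open>The peak is half of \<open>?N\<close> rounded up: \<open>2 * j < ?N\<close>
    holds exactly when \<open>j < ?p\<close>.\<close>
  let ?p = "(?N + 1) div 2"
  have fin: "finite (verts G)"
    using G by (simp add: finite_simple_graph_def)
  \<comment> \<open>The full vertex set dominates, so the degree is at least \<open>?N\<close>, and
    the peak does not exceed it.\<close>
  have "{U. dominating G U \<and> card U = ?N} = {verts G}"
    using fin card_subset_eq[OF fin] unfolding dominating_def by blast
  then have "coeff (domination_poly G) ?N \<noteq> 0"
    by (simp add: coeff_domination_poly[OF G] num_dominating_def)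
  then have deg: "?p \<le> degree (domination_poly G)"
    using le_degree[of "domination_poly G" ?N] by linarith
  have up: "num_dominating G i \<le> num_dominating G j" if "i \<le> j" "j \<le> ?p" for i j
    using that
  proof (induction j rule: dec_induct)
    case (step j)
    then show ?case
      using num_dominating_le_Suc[OF fin, of j] by force
  qed simp
  have down: "num_dominating G j \<le> num_dominating G i" if "?p \<le> i" "i \<le> j" for i j
    using that(2)
  proof (induction j rule: dec_induct)
    case (step j)
    have "?N \<le> 2 * j"
      using step that by linarith
    then show ?case
      using num_dominating_Suc_le[OF fin reg _ small, of j] step by force
  qed simp
  show ?thesis
    unfolding unimodal_def coeff_domination_poly[OF G]
    using deg up down by (intro exI[of _ ?p]) auto
qed

section \<open>Binomial and power estimates\<close>

text \<open>Lowering the upper index from \<open>M + 1\<close> to \<open>M\<close> multiplies the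
  binomial by \<open>(M + 1 - i) / (M + 1)\<close>, which is at most one half while
  \<open>i \<le> M\<close> and \<open>M + 1 \<le> 2 * i\<close>.\<close>

lemma power2_mult_binomial_diff_le:
  assumes "N \<le> 2 * i" and "k \<le> N"
  shows "2 ^ k * ((N - k) choose i) \<le> N choose i"
  using assms(2)
proof (induction k)
  case (Suc k)
  define M where "M = N - Suc k"
  have M: "N - k = Suc M"
    using Suc.prems by (simp add: M_def)
  have "Suc M * (2 * (M choose i)) \<le> Suc M * (Suc M choose i)"
  proof (cases "i \<le> M")
    case True
    have "Suc M * (2 * (M choose i)) = 2 * (Suc M - i) * (Suc M choose i)"
      using binomial_absorb_comp[of "Suc M" i] by simp
    also have "\<dots> \<le> Suc M * (Suc M choose i)"
      using True M assms(1) by (intro mult_right_mono) auto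
    finally show ?thesis .
  qed (simp add: binomial_eq_0)
  then have "2 * (M choose i) \<le> (N - k) choose i"
    unfolding M by (simp only: Suc_mult_le_cancel1)
  then have "2 ^ k * (2 * (M choose i)) \<le> 2 ^ k * ((N - k) choose i)"
    by simp
  also have "\<dots> \<le> N choose i"
    using Suc by simp
  finally show ?case
    by (simp add: M_def mult.assoc mult.left_commute)
qed simp

text \<open>The threshold is sharp: both sides are 512 at \<open>s = 8\<close>, and the bound fails
  at 7. The induction step needs \<open>3 * s ^ 2 + 3 * s + 1 \<le> s ^ 3\<close>.\<close>

lemma cube_le_power2:
  fixes s :: nat
  assumes "8 \<le> s"
  shows "s ^ 3 \<le> 2 ^ Suc s"
  using assms
proof (induction s rule: dec_induct)
  case (step s)
  have "8 * (s * s) \<le> s * (s * s)" "8 * s \<le> s * s"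
    using step.hyps by (simp_all add: mult_le_mono1)
  then have "Suc s ^ 3 \<le> 2 * s ^ 3"
    using step.hyps by (simp add: eval_nat_numeral algebra_simps)
  with step.IH show ?case
    by simp
qed simp

lemma rook_size_bound:
  fixes m n :: nat
  assumes "8 \<le> m + n"
  shows "(m + n) * (m * n) \<le> 2 ^ (m + n - 1)"
proof -
  \<comment> \<open>The inequality of arithmetic and geometric means, over the integers so that
    \<open>m - n\<close> is not truncated.\<close>
  have "int (4 * (m * n)) \<le> int ((m + n) ^ 2)"
    using zero_le_power2[of "int m - int n"] by (simp add: power2_eq_square algebra_simps)
  then have "(m + n) * (4 * (m * n)) \<le> (m + n) * (m + n) ^ 2"
    by (intro mult_left_mono) linarith+
  also have "\<dots> = (m + n) ^ 3"
    by (simp add: power3_eq_cube power2_eq_square)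
  also have "\<dots> \<le> 2 ^ Suc (m + n)"
    using assms by (rule cube_le_power2)
  also have "\<dots> = 4 * 2 ^ (m + n - 1)"
    using assms by (cases "m + n") auto
  finally show ?thesis
    by simp
qed

lemma rook_binomial_bound:
  fixes m n i :: nat
  assumes "m \<ge> 1" and "n \<ge> 1" and i: "m * n \<le> 2 * i"
  shows "(m + n) * (m * n) * ((m * n - (m + n - 1)) choose i) \<le> (m * n) choose i"
proof -
  obtain a b where ab: "m = Suc a" "n = Suc b"
    using assms by (metis One_nat_def Suc_le_D)
  have diff: "m * n - (m + n - 1) = a * b"
    by (simp add: ab)
  consider "8 \<le> m + n" | "a * b < i" | "m = 3" "n = 4" "i = 6" | "m = 4" "n = 3" "i = 6"
  proof -
    have "8 \<le> m + n \<or> a * b < i \<or> m = 3 \<and> n = 4 \<and> i = 6 \<or> m = 4 \<and> n = 3 \<and> i = 6"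
    proof (cases "8 \<le> m + n")
      case False
      \<comment> \<open>Once \<open>a\<close> is a numeral, \<open>a * b\<close> and
        \<open>m * n\<close> are linear in \<open>b\<close>, and linear arithmetic decides each
        case.\<close>
      then have "a = 0 \<or> a = 1 \<or> a = 2 \<or> a = 3 \<or> a = 4 \<or> a = 5" "a + b \<le> 5"
        using assms by (auto simp: ab)
      then show ?thesis
        using i by (elim disjE; simp add: ab; presburger)
    qed simp
    then show thesis using that by blast
  qed
  then show ?thesis
  proof cases
    case 1
    have "(m + n) * (m * n) * ((m * n - (m + n - 1)) choose i) \<le>
        2 ^ (m + n - 1) * ((m * n - (m + n - 1)) choose i)"
      using rook_size_bound[OF 1] by (rule mult_right_mono) simp
    also have "\<dots> \<le> (m * n) choose i"
      using i by (rule power2_mult_binomial_diff_le) (simp add: ab)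
    finally show ?thesis .
  next
    case 2
    then show ?thesis
      unfolding diff by (simp add: binomial_eq_0)
  \<comment> \<open>The two exceptional cases amount to \<open>7 * 12 * 1 \<le> 924\<close>.\<close>
  qed (simp_all add: eval_nat_numeral binomial_Suc_Suc)
qed

section \<open>Closed neighbourhoods in the rook's graph\<close>

text \<open>An edge can be written as a pair in two orders; the adjacency condition is symmetric, so
  the order does not matter.\<close>

lemma edge_cartesian_product_iff:
  "{(a, b), (g, h)} \<in> edges (G \<box> H) \<longleftrightarrow>
    (a, b) \<in> verts G \<times> verts H \<and> (g, h) \<in> verts G \<times> verts H \<and>
    (a = g \<and> {b, h} \<in> edges H \<or> {a, g} \<in> edges G \<and> b = h)"
  by (auto simp: cartesian_product_def doubleton_eq_iff insert_commute)

lemma edge_complete_graph_iff: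
  "{a, b} \<in> edges (complete_graph n) \<longleftrightarrow> a \<in> {1..n} \<and> b \<in> {1..n} \<and> a \<noteq> b"
  by (auto simp: complete_graph_def card_insert_if)

lemma verts_rook: "verts (complete_graph m \<box> complete_graph n) = {1..m} \<times> {1..n}"
  by (simp add: cartesian_product_def complete_graph_def)

text \<open>A rook attacks its row and column. The vertex itself is left out of the second part, so
  the union is disjoint and the sizes add.\<close>

lemma closed_nbhd_rook:
  assumes "g \<in> {1..m}" and "h \<in> {1..n}"
  shows "closed_nbhd (complete_graph m \<box> complete_graph n) (g, h) =
    {g} \<times> {1..n} \<union> ({1..m} - {g}) \<times> {h}"
  using assms
  by (auto simp: closed_nbhd_def verts_rook edge_cartesian_product_iff edge_complete_graph_iff)
     (auto simp: complete_graph_def)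

lemma card_closed_nbhd_rook:
  assumes "v \<in> verts (complete_graph m \<box> complete_graph n)"
  shows "card (closed_nbhd (complete_graph m \<box> complete_graph n) v) = m + n - 1"
proof -
  obtain g h where v: "v = (g, h)" and gh: "g \<in> {1..m}" "h \<in> {1..n}"
    using assms by (auto simp: verts_rook)
  have "card ({g} \<times> {1..n} \<union> ({1..m} - {g}) \<times> {h}) =
      card ({g} \<times> {1..n}) + card (({1..m} - {g}) \<times> {h})"
    by (intro card_Un_disjoint) auto
  also have "\<dots> = m + n - 1"
    using gh by (simp add: card_cartesian_product)
  finally show ?thesis
    by (simp only: v closed_nbhd_rook[OF gh])
qed

theorem theorem5p6:
  fixes m n :: nat
  assumes "m \<ge> 1" and "n \<ge> 1"
  shows "unimodal (domination_poly (complete_graph m \<box> complete_graph n))"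
proof (rule unimodal_domination_poly_regular[where k = "m + n - 1"])
  show "finite_simple_graph (complete_graph m \<box> complete_graph n)"
    by (intro finite_simple_graph_cartesian_product finite_simple_graph_complete_graph)
next
  fix i
  have "card (verts (complete_graph m \<box> complete_graph n)) = m * n"
    by (simp add: verts_rook card_cartesian_product)
  moreover assume "card (verts (complete_graph m \<box> complete_graph n)) \<le> 2 * i"
  ultimately show "Suc (m + n - 1) * card (verts (complete_graph m \<box> complete_graph n)) *
      (card (verts (complete_graph m \<box> complete_graph n)) - (m + n - 1) choose i) \<le>
      card (verts (complete_graph m \<box> complete_graph n)) choose i"
    using rook_binomial_bound[OF assms, of i] assms by simp
qed (rule card_closed_nbhd_rook)

end
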